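(* Let $0<\alpha<1$ and $\Lambda>0$. For $(x,c)\in\mathbb{R}^2_+=[0,+\infty)\times[0,+\infty)$, let $T(x,c)$ be the settling time to go from $(x,y_c(x))$ to the origin along the stable manifold $\{y=y_c(x)\}$ of $X_c$. Then $T(x,c)$ is finite for any $(x,c)\in\mathbb{R}^2_+$. Moreover, $T(x,c)$ is continuous on $\mathbb{R}^2_+$ and such that $T(0,c)=0$. In the interval $0<x<x_1(c)=\Big(\frac{2\Lambda}{(1+\alpha)c^2}\Big)^{\frac1{1-\alpha}}$ we have the following bounds for $T(x,c)$: $$\frac{(2(1+\alpha)\Lambda)^{1/2}}{1-\alpha}x^{\frac{1-\alpha}{2}}<T(x,c)<\frac{(2(1+\alpha)\Lambda)^{1/2}}{1-\alpha}x^{\frac{1-\alpha}{2}}\Big(1-c\Big(\frac{1+\alpha}{2\Lambda}\Big)^{1/2}x^{\frac{1-\alpha}{2}}\Big)^{-1},$$ which gives the following asymptotic expansion at $(0,c)$: $$T(x,c)=\frac{(2(1+\alpha)\Lambda)^{1/2}}{1-\alpha}x^{\frac{1-\alpha}{2}}+O(cx^{1-\alpha}),$$ where the remainder is uniform in $c$ when $c$ is restricted to a compact subset of $[0,+\infty)$.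
   Context: $X_c$ ($c\ge0$) is the vector field on $Q=\{(x,y):x\ge0,\ y\le0\}$ with differential system $x'=y$, $y'=\frac1\Lambda(cy+x^\alpha)$. There is a unique (nonconstant) orbit of $X_c$ in $Q$ tending to the origin in positive time; it is the graph over $(0,+\infty)$ of a function $y_c$, analytic and negative for $x>0$, continuous at $0$ with $y_c(0)=0$. This graph $\{y=y_c(x)\}$ is called the stable manifold of $X_c$. The settling time is $T(x,c)=\int_0^x\frac{ds}{|y_c(s)|}$.
   Formalization: The strict two-sided bounds on T(x,c) for 0<x<x_1(c) are stated for c>0 only: at c=0 the formula for x_1(c) divides by zero, and T(x,0) equals the leading term exactly, so both strict inequalities fail there. *)

theory Defs
  imports "HOL-Analysis.Analysis" "HOL-Library.Landau_Symbols"
begin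

definition vfield :: "real \<Rightarrow> real \<Rightarrow> real \<Rightarrow> real \<times> real \<Rightarrow> real \<times> real" where
  "vfield \<alpha> \<Lambda> c = (\<lambda>(x, y). (y, (1 / \<Lambda>) * (c * y + x powr \<alpha>)))"

definition quadrant :: "(real \<times> real) set" where
  "quadrant = {(x, y). x \<ge> 0 \<and> y \<le> 0}"

(* S is the trace of a solution of F in U that tends to p in positive time. The open time
   interval (a, b) has extended real end points: the vector fields considered here are not
   Lipschitz at the equilibrium p, which may be reached in finite time, so b is allowed to be
   finite. *)
definition orbit_tending_to ::
  "('a::real_normed_vector \<Rightarrow> 'a) \<Rightarrow> 'a set \<Rightarrow> 'a \<Rightarrow> 'a set \<Rightarrow> bool" where
  "orbit_tending_to F U p S \<longleftrightarrow>
     (\<exists>(a::ereal) (b::ereal) \<gamma>. a < b \<and>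
        (\<forall>t\<in>einterval a b. \<gamma> t \<in> U \<and> (\<gamma> has_vector_derivative F (\<gamma> t)) (at t)) \<and>
        \<gamma> ` einterval a b = S \<and>
        ((\<gamma> \<circ> real_of_ereal) \<longlongrightarrow> p) (at_left b))"

definition real_analytic_on :: "(real \<Rightarrow> real) \<Rightarrow> real set \<Rightarrow> bool" where
  "real_analytic_on f S \<longleftrightarrow> (\<forall>x\<in>S. \<exists>P. (\<lambda>h. f (x + h)) has_fps_expansion P)"

(* y is the function y_c. Only its values on [0, oo) matter. The trace is required to be the
   whole graph over (0, oo); it is then a maximal orbit in the quadrant without the origin,
   because x' = y < 0 along it. *)
definition stable_manifold_fun :: "real \<Rightarrow> real \<Rightarrow> real \<Rightarrow> (real \<Rightarrow> real) \<Rightarrow> bool" where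
  "stable_manifold_fun \<alpha> \<Lambda> c y \<longleftrightarrow>
     orbit_tending_to (vfield \<alpha> \<Lambda> c) quadrant (0, 0) ((\<lambda>x. (x, y x)) ` {0<..}) \<and>
     (\<forall>x>0. y x < 0) \<and> real_analytic_on y {0<..} \<and>
     y 0 = 0 \<and> continuous (at 0 within {0..}) y"

(* As an extended nonnegative integral, so that finiteness is not built in. *)
definition settling_time :: "(real \<Rightarrow> real) \<Rightarrow> real \<Rightarrow> ennreal" where
  "settling_time y x = (\<integral>\<^sup>+ s \<in> {0<..<x}. ennreal (1 / \<bar>y s\<bar>) \<partial>lborel)"

definition leading_term :: "real \<Rightarrow> real \<Rightarrow> real \<Rightarrow> real" where
  "leading_term \<alpha> \<Lambda> x =
     (2 * (1 + \<alpha>) * \<Lambda>) powr (1/2) / (1 - \<alpha>) * x powr ((1 - \<alpha>) / 2)"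

(* For c > 0 only: the formula has c^2 in a denominator. *)
definition x1 :: "real \<Rightarrow> real \<Rightarrow> real \<Rightarrow> real" where
  "x1 \<alpha> \<Lambda> c = (2 * \<Lambda> / ((1 + \<alpha>) * c^2)) powr (1 / (1 - \<alpha>))"

end

theory Submission
  imports Defs
begin

text \<open>
  Along the stable manifold, \<open>z = - y\<^sub>c\<close> solves \<open>z' = (x powr \<alpha> / z - c) / \<Lambda>\<close> with
  \<open>z 0 = 0\<close>. The right-hand side decreases in \<open>z\<close>, so two solutions with parameters
  \<open>c1 \<le> c2\<close> satisfy \<open>z2 \<le> z1 \<le> z2 + (c2 - c1) * x / \<Lambda>\<close>. Comparing with the explicit
  solution for \<open>c = 0\<close> gives both bounds on the settling time and the integrability of
  \<open>1 / z\<close> at \<open>0\<close>; Lipschitz dependence and monotonicity in \<open>c\<close> give continuity of the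
  settling time by dominated convergence.
\<close>

section \<open>Comparison principle and the scalar equation of the stable manifold\<close>

text \<open>After its last point with \<open>v \<le> 0\<close> the function would be positive, hence
  nonincreasing, so it cannot climb above zero. The derivative is constrained only where
  \<open>v x > 0\<close> and \<open>x > 0\<close>: there the sign of a difference of two solutions
  is known and the equation is not singular.\<close>

lemma nonpos_if_deriv_nonpos_where_pos:
  fixes v D :: "real \<Rightarrow> real"
  assumes cont: "continuous_on {0..} v" and v0: "v 0 \<le> 0"
    and der: "\<And>x. x > 0 \<Longrightarrow> v x > 0 \<Longrightarrow> (v has_real_derivative D x) (at x) \<and> D x \<le> 0"
    and "x \<ge> 0"
  shows "v x \<le> 0"
proof (rule ccontr)
  assume "\<not> v x \<le> 0"
  \<comment> \<open>\<open>A\<close> is compact and contains 0, so it has a last point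
    \<open>s\<close>; it lies before \<open>x\<close>, where \<open>v\<close> is assumed
    positive.\<close>
  define A where "A = {0..x} \<inter> v -` {..0}"
  have "closed A"
    unfolding A_def
    by (intro continuous_closed_preimage continuous_on_subset[OF cont]) auto
  then have "compact A"
    using bounded_subset[OF bounded_closed_interval[of 0 x], of A]
    by (simp add: A_def compact_eq_bounded_closed)
  moreover have "0 \<in> A" using v0 \<open>x \<ge> 0\<close> by (simp add: A_def)
  ultimately obtain s where s: "s \<in> A" "\<And>t. t \<in> A \<Longrightarrow> t \<le> s"
    using compact_attains_sup[of A] by blast
  have "s < x" using s(1) \<open>\<not> v x \<le> 0\<close> by (force simp: A_def less_le)
  have "0 \<le> s" "v s \<le> 0" using s(1) by (auto simp: A_def)
  have pos: "v t > 0" if "s < t" "t \<le> x" for t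
    using s(2)[of t] that \<open>0 \<le> s\<close> by (force simp: A_def not_le)
  have "v x \<le> v s"
  proof (rule DERIV_nonpos_imp_decreasing_open[of s x v])
    show "\<exists>y. (v has_real_derivative y) (at t) \<and> y \<le> 0" if "s < t" "t < x" for t
      using der[of t] pos[of t] that \<open>0 \<le> s\<close> by auto
    show "continuous_on {s..x} v"
      using \<open>0 \<le> s\<close> by (intro continuous_on_subset[OF cont]) auto
  qed (use \<open>s < x\<close> in simp)
  with pos[of x] \<open>s < x\<close> \<open>v s \<le> 0\<close> show False by simp
qed

lemma real_analytic_on_imp_differentiable:
  assumes "real_analytic_on f S" "x \<in> S"
  shows "f differentiable (at x)"
proof -
  obtain P where P: "(\<lambda>h. f (x + h)) has_fps_expansion P"
    using assms by (auto simp: real_analytic_on_def)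
  then have "0 < fps_conv_radius P"
    and ev: "eventually (\<lambda>h. f (x + h) = eval_fps P h) (nhds 0)"
    by (auto simp: has_fps_expansion_def eq_commute)
  then have "(eval_fps P has_real_derivative eval_fps (fps_deriv P) 0) (at 0)"
    by (intro has_field_derivative_eval_fps) (simp add: zero_ereal_def)
  then have "((\<lambda>h. f (x + h)) has_real_derivative eval_fps (fps_deriv P) 0) (at 0)"
    using DERIV_cong_ev[OF refl ev refl] by simp
  then have "(f has_real_derivative eval_fps (fps_deriv P) 0) (at x)"
    using DERIV_shift[of f _ 0 x] by (simp add: add.commute)
  then show ?thesis
    using real_differentiable_def by blast
qed

text \<open>The slope of the orbit is \<open>y' / x'\<close>: differentiating
  \<open>snd (\<gamma> s) = y (fst (\<gamma> s))\<close> in time, once by the field and once by the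
  chain rule, determines it, since \<open>x' = y x\<close> is nonzero.\<close>

lemma stable_manifold_fun_deriv:
  assumes y: "stable_manifold_fun \<alpha> \<Lambda> c y" and "x > 0"
  shows "(y has_real_derivative (c * y x + x powr \<alpha>) / (\<Lambda> * y x)) (at x)"
proof -
  have orbit: "orbit_tending_to (vfield \<alpha> \<Lambda> c) quadrant (0, 0) ((\<lambda>x. (x, y x)) ` {0<..})"
    and neg: "\<And>x. x > 0 \<Longrightarrow> y x < 0" and ana: "real_analytic_on y {0<..}"
    using y by (auto simp: stable_manifold_fun_def)
  from orbit obtain a b :: ereal and \<gamma>
    where ode: "\<forall>t\<in>einterval a b. \<gamma> t \<in> quadrant \<and>
        (\<gamma> has_vector_derivative vfield \<alpha> \<Lambda> c (\<gamma> t)) (at t)"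
      and img: "\<gamma> ` einterval a b = (\<lambda>x. (x, y x)) ` {0<..}"
    unfolding orbit_tending_to_def by (elim exE conjE)
  have \<gamma>: "(\<gamma> has_vector_derivative vfield \<alpha> \<Lambda> c (\<gamma> t)) (at t)" if "t \<in> einterval a b" for t
    using ode that by simp
  have "(x, y x) \<in> \<gamma> ` einterval a b"
    unfolding img using \<open>x > 0\<close> by auto
  then obtain t where t: "t \<in> einterval a b" and \<gamma>t: "\<gamma> t = (x, y x)"
    by (metis imageE)
  have graph: "snd (\<gamma> s) = y (fst (\<gamma> s))" if "s \<in> einterval a b" for s
  proof -
    have "\<gamma> s \<in> (\<lambda>x. (x, y x)) ` {0<..}" using img that by blast
    then show ?thesis by auto
  qed
  have "((\<lambda>s. fst (\<gamma> s)) has_vector_derivative fst (vfield \<alpha> \<Lambda> c (\<gamma> t))) (at t)"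
    by (rule bounded_linear.has_vector_derivative[OF bounded_linear_fst \<gamma>[OF t]])
  then have d1: "((\<lambda>s. fst (\<gamma> s)) has_real_derivative y x) (at t)"
    by (simp add: \<gamma>t vfield_def has_real_derivative_iff_has_vector_derivative)
  have "((\<lambda>s. snd (\<gamma> s)) has_vector_derivative snd (vfield \<alpha> \<Lambda> c (\<gamma> t))) (at t)"
    by (rule bounded_linear.has_vector_derivative[OF bounded_linear_snd \<gamma>[OF t]])
  then have d2: "((\<lambda>s. snd (\<gamma> s)) has_real_derivative (c * y x + x powr \<alpha>) / \<Lambda>) (at t)"
    by (simp add: \<gamma>t vfield_def has_real_derivative_iff_has_vector_derivative)
  \<comment> \<open>The chain rule needs \<open>y\<close> to be differentiable beforehand;
    analyticity supplies this.\<close>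
  obtain D where D: "(y has_real_derivative D) (at x)"
    using real_analytic_on_imp_differentiable[OF ana, of x] \<open>x > 0\<close>
    by (auto simp: real_differentiable_def)
  have "((\<lambda>s. y (fst (\<gamma> s))) has_real_derivative D * y x) (at t)"
    by (rule DERIV_chain2[OF _ d1]) (simp add: \<gamma>t D)
  \<comment> \<open>The graph identity is known only for times of the orbit; their interval is open,
    so it is a neighbourhood of \<open>t\<close>.\<close>
  moreover have "eventually (\<lambda>s. y (fst (\<gamma> s)) = snd (\<gamma> s)) (nhds t)"
    using eventually_nhds_in_open[OF open_einterval t] by eventually_elim (simp add: graph)
  ultimately have "((\<lambda>s. snd (\<gamma> s)) has_real_derivative D * y x) (at t)"
    using DERIV_cong_ev[of t t "\<lambda>s. y (fst (\<gamma> s))" "\<lambda>s. snd (\<gamma> s)" "D * y x" "D * y x"] by fast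
  then have "D * y x = (c * y x + x powr \<alpha>) / \<Lambda>"
    using d2 by (rule DERIV_unique)
  then have "D = (c * y x + x powr \<alpha>) / (\<Lambda> * y x)"
    using neg[OF \<open>x > 0\<close>] by (simp add: nonzero_eq_divide_eq[symmetric])
  with D show ?thesis by simp
qed

lemma stable_manifold_fun_continuous:
  assumes y: "stable_manifold_fun \<alpha> \<Lambda> c y"
  shows "continuous_on {0..} y"
  unfolding continuous_on_eq_continuous_within
proof
  fix x :: real assume "x \<in> {0..}"
  show "continuous (at x within {0..}) y"
  proof (cases "x = 0")
    case True
    then show ?thesis using y by (simp add: stable_manifold_fun_def)
  next
    case False
    with \<open>x \<in> {0..}\<close> have "x > 0" by simp
    from DERIV_isCont[OF stable_manifold_fun_deriv[OF y this]]
    show ?thesis by (rule continuous_at_imp_continuous_at_within)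
  qed
qed

section \<open>Integrals of powers and strict monotonicity of integrals\<close>

text \<open>For negative \<open>a\<close> the integrand is unbounded at 0. Being nonnegative, it
  lets the gauge integral, known from an antiderivative, carry over to the Lebesgue
  integral.\<close>

lemma has_bochner_integral_powr_from_0:
  fixes a x :: real
  assumes "a > -1" "x \<ge> 0"
  shows "has_bochner_integral lborel (\<lambda>s. indicator {0<..<x} s *\<^sub>R s powr a) (x powr (a + 1) / (a + 1))"
proof (rule has_bochner_integral_nn_integral)
  have "((\<lambda>s. s powr a) has_integral (x powr (a + 1) / (a + 1))) {0<..<x}"
    using has_integral_powr_from_0[OF assms] by (simp add: has_integral_Icc_iff_Ioo)
  then have "((\<lambda>s. if s \<in> {0<..<x} then s powr a else 0) has_integral (x powr (a + 1) / (a + 1))) UNIV"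
    by (simp only: has_integral_restrict_UNIV)
  also have "(\<lambda>s. if s \<in> {0<..<x} then s powr a else 0) = (\<lambda>s. indicator {0<..<x} s *\<^sub>R s powr a)"
    by (auto simp: indicator_def)
  finally show "(\<integral>\<^sup>+ s. ennreal (indicator {0<..<x} s *\<^sub>R s powr a) \<partial>lborel) = ennreal (x powr (a + 1) / (a + 1))"
    by (intro nn_integral_has_integral_lborel) auto
qed (use assms in auto)

text \<open>If the integrals agreed, the nonnegative difference would vanish almost everywhere,
  although it is positive on an interval of positive measure.\<close>

lemma set_integral_strict_mono_Ioo:
  fixes f g :: "real \<Rightarrow> real"
  assumes f: "set_integrable lborel {a<..<b} f" and g: "set_integrable lborel {a<..<b} g"
    and less: "\<And>x. a < x \<Longrightarrow> x < b \<Longrightarrow> f x < g x" and "a < b"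
  shows "(LINT x:{a<..<b}|lborel. f x) < (LINT x:{a<..<b}|lborel. g x)"
proof -
  define h where "h x = indicator {a<..<b} x *\<^sub>R (g x - f x)" for x
  have int: "integrable lborel h"
    using set_integral_diff(1)[OF g f] by (simp add: set_integrable_def h_def[abs_def])
  have nonneg: "0 \<le> h x" for x
    using less[of x] by (auto simp: h_def indicator_def)
  have "integral\<^sup>L lborel h \<noteq> 0"
  proof
    assume "integral\<^sup>L lborel h = 0"
    then have "AE x in lborel. h x = 0"
      using integral_nonneg_eq_0_iff_AE[OF int] nonneg by simp
    then have "AE x in lborel. x \<notin> {a<..<b}"
      by eventually_elim (use less in \<open>force simp: h_def\<close>)
    then have "emeasure lborel {a<..<b} = 0"
      by (subst (asm) AE_iff_measurable[of "{a<..<b}"]) auto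
    then show False using \<open>a < b\<close> by simp
  qed
  moreover have "0 \<le> integral\<^sup>L lborel h"
    using nonneg by (intro integral_nonneg_AE) simp
  moreover have "integral\<^sup>L lborel h = (LINT x:{a<..<b}|lborel. g x) - (LINT x:{a<..<b}|lborel. f x)"
    using set_integral_diff(2)[OF g f] by (simp add: set_lebesgue_integral_def h_def[abs_def])
  ultimately show ?thesis by simp
qed

section \<open>Comparison of solutions with different parameters\<close>

locale stable_branches =
  fixes \<alpha> \<Lambda> :: real
  assumes \<alpha>_pos: "0 < \<alpha>" and \<alpha>_less_1: "\<alpha> < 1" and \<Lambda>_pos: "0 < \<Lambda>"
begin

text \<open>\<open>z\<close> stands for \<open>- y\<^sub>c\<close>.\<close>

definition branch :: "real \<Rightarrow> (real \<Rightarrow> real) \<Rightarrow> bool" where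
  "branch c z \<longleftrightarrow> z 0 = 0 \<and> continuous_on {0..} z \<and>
     (\<forall>x>0. 0 < z x \<and> (z has_real_derivative (x powr \<alpha> / z x - c) / \<Lambda>) (at x))"

lemma branchD:
  assumes "branch c z"
  shows "z 0 = 0" "continuous_on {0..} z" "x > 0 \<Longrightarrow> 0 < z x"
    "x > 0 \<Longrightarrow> (z has_real_derivative (x powr \<alpha> / z x - c) / \<Lambda>) (at x)"
  using assms by (auto simp: branch_def)

lemma branch_stable_manifold_fun:
  assumes y: "stable_manifold_fun \<alpha> \<Lambda> c y"
  shows "branch c (\<lambda>x. - y x)"
proof -
  have neg: "y x < 0" if "x > 0" for x
    using y that by (simp add: stable_manifold_fun_def)
  have "((\<lambda>x. - y x) has_real_derivative (x powr \<alpha> / - y x - c) / \<Lambda>) (at x)" if "x > 0" for x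
    by (rule DERIV_cong[OF DERIV_minus[OF stable_manifold_fun_deriv[OF y that]]])
       (use neg[OF that] \<Lambda>_pos in \<open>simp add: field_simps\<close>)
  then show ?thesis
    using y neg continuous_on_minus[OF stable_manifold_fun_continuous[OF y]]
    by (simp add: branch_def stable_manifold_fun_def)
qed

text \<open>Where a difference of solutions has the unwanted sign, the decreasing term
  \<open>x powr \<alpha> / z\<close> pulls it back, so the sign principle applies to
  \<open>z2 - z1\<close> and to \<open>z1 - z2\<close> minus a linear function.\<close>

lemma branch_comparison:
  assumes z1: "branch c1 z1" and z2: "branch c2 z2" and "c1 \<le> c2" and "0 \<le> x"
  shows "z2 x \<le> z1 x" "z1 x \<le> z2 x + (c2 - c1) * x / \<Lambda>"
proof -
  note c1 = branchD[OF z1] and c2 = branchD[OF z2]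
  have "z2 x - z1 x \<le> 0"
  proof (rule nonpos_if_deriv_nonpos_where_pos[OF _ _ _ \<open>0 \<le> x\<close>])
    show "continuous_on {0..} (\<lambda>x. z2 x - z1 x)"
      by (intro continuous_intros c1 c2)
    fix t :: real assume t: "t > 0" "0 < z2 t - z1 t"
    have "t powr \<alpha> / z2 t \<le> t powr \<alpha> / z1 t"
      using t c1(3)[of t] by (intro divide_left_mono) auto
    then show "((\<lambda>x. z2 x - z1 x) has_real_derivative
        (t powr \<alpha> / z2 t - c2) / \<Lambda> - (t powr \<alpha> / z1 t - c1) / \<Lambda>) (at t) \<and>
        (t powr \<alpha> / z2 t - c2) / \<Lambda> - (t powr \<alpha> / z1 t - c1) / \<Lambda> \<le> 0"
      using t \<open>c1 \<le> c2\<close> \<Lambda>_pos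
      by (auto intro!: DERIV_diff c1 c2 divide_right_mono)
  qed (simp add: c1 c2)
  then show "z2 x \<le> z1 x" by simp
  \<comment> \<open>The slope \<open>(c2 - c1) / \<Lambda>\<close> of the subtracted line is exactly
    what the parameters contribute to the derivative of \<open>z1 - z2\<close>.\<close>
  have "z1 x - z2 x - (c2 - c1) / \<Lambda> * x \<le> 0"
  proof (rule nonpos_if_deriv_nonpos_where_pos[OF _ _ _ \<open>0 \<le> x\<close>])
    show "continuous_on {0..} (\<lambda>x. z1 x - z2 x - (c2 - c1) / \<Lambda> * x)"
      by (intro continuous_intros c1 c2)
    fix t :: real assume t: "t > 0" "0 < z1 t - z2 t - (c2 - c1) / \<Lambda> * t"
    have "0 \<le> (c2 - c1) / \<Lambda> * t"
      using t \<open>c1 \<le> c2\<close> \<Lambda>_pos by simp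
    then have "t powr \<alpha> / z1 t \<le> t powr \<alpha> / z2 t"
      using t c2(3)[of t] by (intro divide_left_mono) auto
    then have "(t powr \<alpha> / z1 t - c1) / \<Lambda> - (t powr \<alpha> / z2 t - c2) / \<Lambda>
        - (c2 - c1) / \<Lambda> \<le> 0"
      using divide_right_mono[of "t powr \<alpha> / z1 t" "t powr \<alpha> / z2 t" \<Lambda>] \<Lambda>_pos
      by (simp add: diff_divide_distrib)
    moreover have "((\<lambda>x. z1 x - z2 x - (c2 - c1) / \<Lambda> * x) has_real_derivative
        (t powr \<alpha> / z1 t - c1) / \<Lambda> - (t powr \<alpha> / z2 t - c2) / \<Lambda> - (c2 - c1) / \<Lambda>) (at t)"
      using t \<Lambda>_pos by (auto intro!: derivative_eq_intros c1 c2)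
    ultimately show "((\<lambda>x. z1 x - z2 x - (c2 - c1) / \<Lambda> * x) has_real_derivative
        (t powr \<alpha> / z1 t - c1) / \<Lambda> - (t powr \<alpha> / z2 t - c2) / \<Lambda> - (c2 - c1) / \<Lambda>) (at t) \<and>
        (t powr \<alpha> / z1 t - c1) / \<Lambda> - (t powr \<alpha> / z2 t - c2) / \<Lambda> - (c2 - c1) / \<Lambda> \<le> 0"
      by blast
  qed (simp add: c1 c2)
  then show "z1 x \<le> z2 x + (c2 - c1) * x / \<Lambda>" by simp
qed

section \<open>The explicit solution for \<open>c = 0\<close> and the bounds it yields\<close>

text \<open>
  With this constant, \<open>z0 x = x powr ((1 + \<alpha>) / 2) / (\<kappa> * \<Lambda>)\<close> is the
  solution for \<open>c = 0\<close>, and \<open>c * \<kappa> * x powr ((1 - \<alpha>) / 2)\<close> is the relative size of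
  the correction \<open>c * x / \<Lambda>\<close> with respect to \<open>z0 x\<close>.
\<close>

definition \<kappa> :: real where "\<kappa> = ((1 + \<alpha>) / (2 * \<Lambda>)) powr (1/2)"

lemma \<kappa>_pos: "0 < \<kappa>"
  using \<alpha>_pos \<Lambda>_pos by (simp add: \<kappa>_def)

lemma \<kappa>_square: "\<kappa>\<^sup>2 = (1 + \<alpha>) / (2 * \<Lambda>)"
  using \<alpha>_pos \<Lambda>_pos by (simp add: \<kappa>_def powr_half_sqrt)

text \<open>The constant is \<open>2 * \<kappa> * \<Lambda>\<close>, whose square is
  \<open>2 * (1 + \<alpha>) * \<Lambda>\<close>; the bracket is the integral of
  \<open>s powr (- ((1 + \<alpha>) / 2))\<close> from 0 to \<open>x\<close>.\<close>

lemma leading_term_eq: "leading_term \<alpha> \<Lambda> x = \<kappa> * \<Lambda> * (2 * x powr ((1 - \<alpha>) / 2) / (1 - \<alpha>))"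
proof -
  have "(2 * (1 + \<alpha>) * \<Lambda>) powr (1/2) = sqrt ((2 * \<kappa> * \<Lambda>)\<^sup>2)"
    using \<alpha>_pos \<Lambda>_pos
    by (simp add: powr_half_sqrt power_mult_distrib \<kappa>_square) (simp add: power2_eq_square)
  also have "\<dots> = 2 * \<kappa> * \<Lambda>"
    using \<kappa>_pos \<Lambda>_pos by simp
  finally show ?thesis by (simp add: leading_term_def)
qed

definition z0 :: "real \<Rightarrow> real" where "z0 x = x powr ((1 + \<alpha>) / 2) / (\<kappa> * \<Lambda>)"

lemma z0_pos: "x > 0 \<Longrightarrow> z0 x > 0"
  using \<kappa>_pos \<Lambda>_pos by (simp add: z0_def)

lemma inverse_z0: "1 / z0 x = \<kappa> * \<Lambda> * x powr (- ((1 + \<alpha>) / 2))"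
  unfolding z0_def powr_minus by (simp only: divide_divide_eq_right divide_inverse mult_1_left mult_ac inverse_mult_distrib inverse_inverse_eq)

text \<open>For \<open>c = 0\<close> the equation separates:
  \<open>z * z' = x powr \<alpha> / \<Lambda>\<close> integrates to \<open>z^2 = 2 * x powr (1 +
  \<alpha>) / ((1 + \<alpha>) * \<Lambda>)\<close>, and the positive root is
  \<open>z0\<close>.\<close>

lemma branch_z0: "branch 0 z0"
  unfolding branch_def
proof (intro conjI allI impI)
  show "continuous_on {0..} z0"
    unfolding z0_def using \<alpha>_pos \<kappa>_pos \<Lambda>_pos
    by (intro continuous_on_divide continuous_on_powr' continuous_on_id continuous_on_const) auto
  fix x :: real assume "0 < x"
  then show "0 < z0 x" by (rule z0_pos)
  have "x powr \<alpha> / z0 x = \<kappa> * \<Lambda> * x powr ((\<alpha> - 1) / 2)"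
  proof -
    have "x powr \<alpha> = x powr ((1 + \<alpha>) / 2) * x powr ((\<alpha> - 1) / 2)"
      unfolding powr_add[symmetric] by (simp add: add_divide_distrib[symmetric])
    then show ?thesis using \<open>0 < x\<close> by (simp add: z0_def)
  qed
  moreover have "((1 + \<alpha>) / 2 * x powr ((1 + \<alpha>) / 2 - 1)) / (\<kappa> * \<Lambda>)
      = \<kappa>\<^sup>2 * \<Lambda> * x powr ((\<alpha> - 1) / 2) / (\<kappa> * \<Lambda>)"
  proof -
    have e1: "(1 + \<alpha>) / 2 - 1 = (\<alpha> - 1) / 2" by (simp add: field_simps)
    have e2: "(1 + \<alpha>) / 2 = \<kappa>\<^sup>2 * \<Lambda>" unfolding \<kappa>_square using \<Lambda>_pos by simp
    show ?thesis unfolding e1 unfolding e2 ..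
  qed
  ultimately have *: "((1 + \<alpha>) / 2 * x powr ((1 + \<alpha>) / 2 - 1)) / (\<kappa> * \<Lambda>) = (x powr \<alpha> / z0 x - 0) / \<Lambda>"
    using \<kappa>_pos \<Lambda>_pos by (simp add: power2_eq_square)
  show "(z0 has_real_derivative (x powr \<alpha> / z0 x - 0) / \<Lambda>) (at x)"
  proof -
    have "((\<lambda>x. x powr ((1 + \<alpha>) / 2) / (\<kappa> * \<Lambda>)) has_real_derivative
        ((1 + \<alpha>) / 2 * x powr ((1 + \<alpha>) / 2 - 1)) / (\<kappa> * \<Lambda>)) (at x)"
      by (rule DERIV_cdivide[OF has_real_derivative_powr[OF \<open>0 < x\<close>]])
    then show ?thesis
      unfolding * by (simp only: z0_def[abs_def])
  qed
qed (simp add: z0_def)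

lemma linear_eq_z0: "x \<ge> 0 \<Longrightarrow> c * x / \<Lambda> = z0 x * (c * \<kappa> * x powr ((1 - \<alpha>) / 2))"
proof -
  assume "x \<ge> 0"
  have "x powr ((1 + \<alpha>) / 2) * x powr ((1 - \<alpha>) / 2) = x"
    using \<open>x \<ge> 0\<close> by (simp add: powr_add[symmetric] add_divide_distrib[symmetric])
  then show ?thesis
    using \<kappa>_pos \<Lambda>_pos by (simp add: z0_def field_simps)
qed

text \<open>Comparison with the parameters 0 and \<open>c\<close>; the additive error
  \<open>c * x / \<Lambda>\<close> becomes a factor of \<open>z0 x\<close>.\<close>

lemma branch_bounds:
  assumes "branch c z" "0 \<le> c" "0 \<le> x"
  shows "z x \<le> z0 x" "z0 x * (1 - c * \<kappa> * x powr ((1 - \<alpha>) / 2)) \<le> z x"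
  using branch_comparison[OF branch_z0 assms] linear_eq_z0[OF \<open>0 \<le> x\<close>, of c]
  by (auto simp: algebra_simps)

text \<open>At a contact point \<open>z0 - z\<close> would have a local minimum, yet there the two
  equations give it the slope \<open>c / \<Lambda> > 0\<close>.\<close>

lemma branch_less_z0:
  assumes z: "branch c z" and "0 < c" "0 < x"
  shows "z x < z0 x"
proof (rule ccontr)
  assume "\<not> z x < z0 x"
  then have eq: "z x = z0 x"
    using branch_bounds[OF z, of x] assms by simp
  have "((\<lambda>t. z0 t - z t) has_real_derivative
      (x powr \<alpha> / z0 x - 0) / \<Lambda> - (x powr \<alpha> / z x - c) / \<Lambda>) (at x)"
    by (intro DERIV_diff branchD(4)[OF branch_z0] branchD(4)[OF z] \<open>0 < x\<close>)
  then have "((\<lambda>t. z0 t - z t) has_real_derivative c / \<Lambda>) (at x)"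
    by (simp add: eq diff_divide_distrib)
  \<comment> \<open>The radius \<open>x\<close> keeps \<open>t\<close> positive, where
    \<open>z \<le> z0\<close> is available.\<close>
  moreover have "\<forall>t. \<bar>x - t\<bar> < x \<longrightarrow> z0 x - z x \<le> z0 t - z t"
    using branch_bounds(1)[OF z] \<open>0 < c\<close> by (auto simp: eq)
  ultimately have "c / \<Lambda> = 0"
    using DERIV_local_min \<open>0 < x\<close> by blast
  then show False using \<open>0 < c\<close> \<Lambda>_pos by simp
qed


section \<open>Integrability of the reciprocal at the origin\<close>

text \<open>The exponent \<open>- ((1 + \<alpha>) / 2)\<close> exceeds -1 because
  \<open>\<alpha> < 1\<close>; this is why the origin is reached in finite time.\<close>

lemma inverse_z0_integral:
  assumes "x \<ge> 0"
  shows "set_integrable lborel {0<..<x} (\<lambda>s. 1 / z0 s)"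
    and "(LINT s:{0<..<x}|lborel. 1 / z0 s) = leading_term \<alpha> \<Lambda> x"
proof -
  have e: "- ((1 + \<alpha>) / 2) + 1 = (1 - \<alpha>) / 2" by (simp add: field_simps)
  have "has_bochner_integral lborel (\<lambda>s. \<kappa> * \<Lambda> * (indicator {0<..<x} s *\<^sub>R s powr (- ((1 + \<alpha>) / 2))))
      (\<kappa> * \<Lambda> * (x powr ((1 - \<alpha>) / 2) / ((1 - \<alpha>) / 2)))"
    using has_bochner_integral_powr_from_0[of "- ((1 + \<alpha>) / 2)" x, unfolded e] \<alpha>_less_1 assms
    by (intro has_bochner_integral_mult_right) auto
  also have "(\<lambda>s. \<kappa> * \<Lambda> * (indicator {0<..<x} s *\<^sub>R s powr (- ((1 + \<alpha>) / 2))))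
      = (\<lambda>s. indicator {0<..<x} s *\<^sub>R (1 / z0 s))"
    unfolding inverse_z0 by (simp add: mult_ac)
  also have "\<kappa> * \<Lambda> * (x powr ((1 - \<alpha>) / 2) / ((1 - \<alpha>) / 2)) = leading_term \<alpha> \<Lambda> x"
    by (simp add: leading_term_eq)
  finally have *: "has_bochner_integral lborel (\<lambda>s. indicator {0<..<x} s *\<^sub>R (1 / z0 s)) (leading_term \<alpha> \<Lambda> x)" .
  show "set_integrable lborel {0<..<x} (\<lambda>s. 1 / z0 s)"
    using * unfolding set_integrable_def by (rule integrable.intros)
  show "(LINT s:{0<..<x}|lborel. 1 / z0 s) = leading_term \<alpha> \<Lambda> x"
    using * unfolding set_lebesgue_integral_def by (rule has_bochner_integral_integral_eq)
qed

lemma eventually_defect_less: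
  "eventually (\<lambda>x. c * \<kappa> * x powr ((1 - \<alpha>) / 2) < 1 / 2) (at_right 0)"
proof -
  \<comment> \<open>The exponent is positive and \<open>0 powr a\<close> is 0, so the limit is
    0.\<close>
  have "((\<lambda>x. c * \<kappa> * x powr ((1 - \<alpha>) / 2)) \<longlongrightarrow> c * \<kappa> * 0 powr ((1 - \<alpha>) / 2)) (at_right 0)"
    using \<alpha>_less_1 by (intro tendsto_intros tendsto_powr')
      (auto simp: eventually_at_filter)
  then show ?thesis
    by (rule order_tendstoD) (simp)
qed

lemma branch_continuous_on_inverse:
  assumes z: "branch c z" and "A \<subseteq> {0<..}"
  shows "continuous_on A (\<lambda>s. 1 / z s)"
proof -
  have "z s \<noteq> 0" if "s \<in> A" for s
    using branchD(3)[OF z, of s] that \<open>A \<subseteq> {0<..}\<close> by auto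
  moreover have "continuous_on A z"
    by (rule continuous_on_subset[OF branchD(2)[OF z]]) (use \<open>A \<subseteq> {0<..}\<close> in auto)
  ultimately show ?thesis by (intro continuous_intros) auto
qed

text \<open>Near 0 the lower bound gives \<open>z \<ge> z0 / 2\<close>, so \<open>2 / z0\<close>
  dominates; away from 0 the reciprocal is continuous on a compact interval.\<close>

lemma branch_set_integrable:
  assumes z: "branch c z" and "c \<ge> 0"
  shows "set_integrable lborel {0<..<x} (\<lambda>s. 1 / z s)"
proof -
  obtain e where "e > 0" and e: "\<And>s. 0 < s \<Longrightarrow> s < e \<Longrightarrow> c * \<kappa> * s powr ((1 - \<alpha>) / 2) < 1 / 2"
    using eventually_defect_less[of c] by (auto simp: eventually_at_right_field)
  have "set_integrable lborel {0<..<e} (\<lambda>s. 1 / z s)"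
  proof (rule set_integrable_bound)
    show "set_integrable lborel {0<..<e} (\<lambda>s. 2 * (1 / z0 s))"
      using inverse_z0_integral(1)[of e] \<open>e > 0\<close> by (intro set_integrable_mult_right) auto
    show "set_borel_measurable lborel {0<..<e} (\<lambda>s. 1 / z s)"
      unfolding set_borel_measurable_def
      using borel_measurable_continuous_on_indicator[OF _ branch_continuous_on_inverse[OF z], of "{0<..<e}"]
      by fastforce
    have "norm (1 / z s) \<le> norm (2 * (1 / z0 s))" if "0 < s" "s < e" for s
    proof -
      have "1 / 2 \<le> 1 - c * \<kappa> * s powr ((1 - \<alpha>) / 2)"
        using e[OF that] by simp
      from mult_left_mono[OF this, of "z0 s"] branch_bounds(2)[OF z \<open>c \<ge> 0\<close>, of s]
      have "z0 s / 2 \<le> z s"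
        using that z0_pos[of s] by linarith
      then show ?thesis
        using z0_pos[of s] that branchD(3)[OF z, of s] by (simp add: field_simps)
    qed
    then show "AE s in lborel. s \<in> {0<..<e} \<longrightarrow> norm (1 / z s) \<le> norm (2 * (1 / z0 s))"
      by simp
  qed
  \<comment> \<open>For \<open>x < e\<close> this interval is empty and the first piece already
    covers \<open>{0<..<x}\<close>.\<close>
  moreover have "set_integrable lborel {e..x} (\<lambda>s. 1 / z s)"
    using \<open>e > 0\<close> by (intro borel_integrable_atLeastAtMost' branch_continuous_on_inverse[OF z]) auto
  ultimately have "set_integrable lborel ({0<..<e} \<union> {e..x}) (\<lambda>s. 1 / z s)"
    by (rule set_integrable_Un) auto
  then show ?thesis
    by (rule set_integrable_subset) auto
qed

section \<open>Settling time as a real integral, with its two-sided bounds\<close>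

text \<open>The real counterpart of \<open>settling_time\<close>. A Lebesgue integral defaults to 0
  without integrability, so the value is meaningful only through
  \<open>branch_set_integrable\<close>.\<close>

definition time :: "(real \<Rightarrow> real) \<Rightarrow> real \<Rightarrow> real" where
  "time z x = (LINT s:{0<..<x}|lborel. 1 / z s)"

lemma settling_time_eq:
  assumes y: "stable_manifold_fun \<alpha> \<Lambda> c y" and "c \<ge> 0"
  shows "settling_time y x = ennreal (time (\<lambda>x. - y x) x)"
proof -
  have neg: "y s < 0" if "s > 0" for s
    using y that by (simp add: stable_manifold_fun_def)
  have "settling_time y x = (\<integral>\<^sup>+ s. ennreal (indicator {0<..<x} s *\<^sub>R (1 / - y s)) \<partial>lborel)"
    unfolding settling_time_def
    by (intro nn_integral_cong) (use neg in \<open>auto simp: indicator_def abs_of_neg\<close>)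
  also have "\<dots> = ennreal (time (\<lambda>x. - y x) x)"
    unfolding time_def set_lebesgue_integral_def
    using branch_set_integrable[OF branch_stable_manifold_fun[OF y] \<open>c \<ge> 0\<close>, of x]
    by (intro nn_integral_eq_integral) (use neg in \<open>auto simp: set_integrable_def indicator_def less_imp_le\<close>)
  finally show ?thesis .
qed

lemma time_nonneg: "branch c z \<Longrightarrow> 0 \<le> time z x"
  unfolding time_def set_lebesgue_integral_def
  using branchD(3)[of c z]
  by (intro integral_nonneg_AE) (auto simp: indicator_def less_imp_le)

text \<open>The weak form covers \<open>c = 0\<close>, where the strict bound fails; the expansion
  needs it because the parameter set may contain 0.\<close>

lemma leading_term_le_time:
  assumes z: "branch c z" and "0 \<le> c" "0 \<le> x"
  shows "leading_term \<alpha> \<Lambda> x \<le> time z x"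
  unfolding inverse_z0_integral(2)[OF \<open>0 \<le> x\<close>, symmetric] time_def
  using branch_bounds(1)[OF z \<open>0 \<le> c\<close>] branchD(3)[OF z] z0_pos
  by (intro set_integral_mono inverse_z0_integral branch_set_integrable[OF z] assms)
     (simp add: frac_le)

lemma leading_term_less_time:
  assumes z: "branch c z" and "0 < c" "0 < x"
  shows "leading_term \<alpha> \<Lambda> x < time z x"
  unfolding inverse_z0_integral(2)[OF less_imp_le[OF \<open>0 < x\<close>], symmetric] time_def
  using branch_less_z0[OF z \<open>0 < c\<close>] branchD(3)[OF z] z0_pos assms(2,3)
  by (intro set_integral_strict_mono_Ioo inverse_z0_integral branch_set_integrable[OF z])
     (simp_all add: frac_less2)

text \<open>Smallness at the right end \<open>x\<close> passes to every smaller \<open>s\<close> by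
  monotonicity, so the lower bound for \<open>z s\<close> is positive and can be inverted.\<close>

lemma inverse_branch_le:
  assumes z: "branch c z" and "0 \<le> c" "0 < s" "s \<le> x"
    and small: "c * \<kappa> * x powr ((1 - \<alpha>) / 2) < 1"
  shows "1 / z s \<le> inverse (1 - c * \<kappa> * s powr ((1 - \<alpha>) / 2)) * (1 / z0 s)"
proof -
  have "c * \<kappa> * s powr ((1 - \<alpha>) / 2) \<le> c * \<kappa> * x powr ((1 - \<alpha>) / 2)"
    using assms \<kappa>_pos \<alpha>_less_1 by (intro mult_left_mono powr_mono2) auto
  with small have "0 < 1 - c * \<kappa> * s powr ((1 - \<alpha>) / 2)" by simp
  then have "0 < z0 s * (1 - c * \<kappa> * s powr ((1 - \<alpha>) / 2))"
    using z0_pos[OF \<open>0 < s\<close>] by simp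
  with branch_bounds(2)[OF z \<open>0 \<le> c\<close>, of s] \<open>0 < s\<close>
  have "1 / z s \<le> 1 / (z0 s * (1 - c * \<kappa> * s powr ((1 - \<alpha>) / 2)))"
    by (intro divide_left_mono) auto
  then show ?thesis
    by (simp only: divide_inverse inverse_mult_distrib mult_1_left mult.commute)
qed

lemma scaled_inverse_z0_integral:
  assumes "0 \<le> x"
  shows "set_integrable lborel {0<..<x} (\<lambda>s. k * (1 / z0 s))"
    and "(LINT s:{0<..<x}|lborel. k * (1 / z0 s)) = leading_term \<alpha> \<Lambda> x * k"
proof -
  show "set_integrable lborel {0<..<x} (\<lambda>s. k * (1 / z0 s))"
    using inverse_z0_integral(1)[OF assms] by (intro set_integrable_mult_right) auto
  show "(LINT s:{0<..<x}|lborel. k * (1 / z0 s)) = leading_term \<alpha> \<Lambda> x * k"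
    unfolding set_integral_mult_right inverse_z0_integral(2)[OF assms] by simp
qed

text \<open>The factor in \<open>inverse_branch_le\<close> increases with \<open>s\<close>; it is
  replaced by its value at \<open>x\<close> and taken out of the integral.\<close>

lemma time_le:
  assumes z: "branch c z" and "0 \<le> c" "0 \<le> x"
    and small: "c * \<kappa> * x powr ((1 - \<alpha>) / 2) < 1"
  shows "time z x \<le> leading_term \<alpha> \<Lambda> x * inverse (1 - c * \<kappa> * x powr ((1 - \<alpha>) / 2))"
  unfolding scaled_inverse_z0_integral(2)[OF \<open>0 \<le> x\<close>, symmetric] time_def
proof (intro set_integral_mono branch_set_integrable[OF z \<open>0 \<le> c\<close>] scaled_inverse_z0_integral(1) \<open>0 \<le> x\<close>)
  fix s assume s: "s \<in> {0<..<x}"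
  have "c * \<kappa> * s powr ((1 - \<alpha>) / 2) \<le> c * \<kappa> * x powr ((1 - \<alpha>) / 2)"
    using s assms \<kappa>_pos \<alpha>_less_1 by (intro mult_left_mono powr_mono2) auto
  then have "inverse (1 - c * \<kappa> * s powr ((1 - \<alpha>) / 2)) * (1 / z0 s)
      \<le> inverse (1 - c * \<kappa> * x powr ((1 - \<alpha>) / 2)) * (1 / z0 s)"
    using small z0_pos[of s] s by (intro mult_right_mono le_imp_inverse_le) auto
  with inverse_branch_le[OF z \<open>0 \<le> c\<close> _ _ small, of s] s
  show "1 / z s \<le> inverse (1 - c * \<kappa> * x powr ((1 - \<alpha>) / 2)) * (1 / z0 s)"
    by auto
qed

text \<open>For \<open>c > 0\<close> that factor is strictly increasing, so replacing it by its
  value at \<open>x\<close> is a strict step for every \<open>s < x\<close>.\<close>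

lemma time_less:
  assumes z: "branch c z" and "0 < c" "0 < x"
    and small: "c * \<kappa> * x powr ((1 - \<alpha>) / 2) < 1"
  shows "time z x < leading_term \<alpha> \<Lambda> x * inverse (1 - c * \<kappa> * x powr ((1 - \<alpha>) / 2))"
  unfolding scaled_inverse_z0_integral(2)[OF less_imp_le[OF \<open>0 < x\<close>], symmetric] time_def
proof (intro set_integral_strict_mono_Ioo branch_set_integrable[OF z] scaled_inverse_z0_integral(1))
  fix s assume s: "0 < s" "s < x"
  have "c * \<kappa> * s powr ((1 - \<alpha>) / 2) < c * \<kappa> * x powr ((1 - \<alpha>) / 2)"
    using s assms \<kappa>_pos \<alpha>_less_1 by (intro mult_strict_left_mono powr_less_mono2) auto
  then have "inverse (1 - c * \<kappa> * s powr ((1 - \<alpha>) / 2)) * (1 / z0 s)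
      < inverse (1 - c * \<kappa> * x powr ((1 - \<alpha>) / 2)) * (1 / z0 s)"
    using small z0_pos[of s] s by (intro mult_strict_right_mono less_imp_inverse_less) auto
  with inverse_branch_le[OF z _ _ _ small, of s] s \<open>0 < c\<close>
  show "1 / z s < inverse (1 - c * \<kappa> * x powr ((1 - \<alpha>) / 2)) * (1 / z0 s)"
    by auto
qed (use assms in auto)

text \<open>\<open>x1\<close> is the point at which the left-hand side equals 1, since there
  \<open>x powr ((1 - \<alpha>) / 2) = 1 / (c * \<kappa>)\<close>.\<close>

lemma defect_less_1:
  assumes "0 < c" "0 < x" "x < x1 \<alpha> \<Lambda> c"
  shows "c * \<kappa> * x powr ((1 - \<alpha>) / 2) < 1"
proof -
  have "x powr ((1 - \<alpha>) / 2) < x1 \<alpha> \<Lambda> c powr ((1 - \<alpha>) / 2)"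
    using assms \<alpha>_less_1 by (intro powr_less_mono2) auto
  also have "\<dots> = (2 * \<Lambda> / ((1 + \<alpha>) * c\<^sup>2)) powr (1 / 2)"
    using \<alpha>_less_1 by (simp add: x1_def powr_powr)
  also have "2 * \<Lambda> / ((1 + \<alpha>) * c\<^sup>2) = (1 / (c * \<kappa>))\<^sup>2"
    by (simp add: power_divide power_mult_distrib \<kappa>_square)
  also have "\<dots> powr (1 / 2) = 1 / (c * \<kappa>)"
    by (subst powr_half_sqrt, simp, subst real_sqrt_unique[OF refl])
       (use \<kappa>_pos \<open>0 < c\<close> in simp_all)
  finally show ?thesis
    using \<kappa>_pos \<open>0 < c\<close> by (simp add: field_simps)
qed

section \<open>Joint continuity in position and parameter\<close>

text \<open>Comparison makes \<open>z c s\<close> Lipschitz in \<open>c\<close> with constant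
  \<open>s / \<Lambda>\<close>.\<close>

lemma branch_parameter_continuous:
  assumes br: "\<And>c. c \<ge> 0 \<Longrightarrow> branch c (z c)"
    and C: "C \<longlonglongrightarrow> c" "\<And>n. C n \<ge> 0" "c \<ge> 0" and "s \<ge> 0"
  shows "(\<lambda>n. z (C n) s) \<longlonglongrightarrow> z c s"
proof -
  have lip: "\<bar>z a s - z b s\<bar> \<le> \<bar>a - b\<bar> * s / \<Lambda>" if "a \<ge> 0" "b \<ge> 0" for a b
    using branch_comparison[OF br[OF \<open>a \<ge> 0\<close>] br[OF \<open>b \<ge> 0\<close>] _ \<open>s \<ge> 0\<close>]
      branch_comparison[OF br[OF \<open>b \<ge> 0\<close>] br[OF \<open>a \<ge> 0\<close>] _ \<open>s \<ge> 0\<close>]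
    by (cases "a \<le> b") (auto simp: abs_real_def)
  have "(\<lambda>n. \<bar>C n - c\<bar> * s / \<Lambda>) \<longlonglongrightarrow> \<bar>c - c\<bar> * s / \<Lambda>"
    using \<Lambda>_pos by (intro tendsto_intros C) auto
  then have "(\<lambda>n. \<bar>C n - c\<bar> * s / \<Lambda>) \<longlonglongrightarrow> 0" by simp
  then have "(\<lambda>n. z (C n) s - z c s) \<longlonglongrightarrow> 0"
    by (rule Lim_null_comparison[rotated]) (use lip C in auto)
  then show ?thesis by (simp add: LIM_zero_iff)
qed

lemma time_sequentially_continuous:
  assumes br: "\<And>c. c \<ge> 0 \<Longrightarrow> branch c (z c)"
    and X: "X \<longlonglongrightarrow> x" and C: "C \<longlonglongrightarrow> c" "\<And>n. C n \<ge> 0" "c \<ge> 0"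
  shows "(\<lambda>n. time (z (C n)) (X n)) \<longlonglongrightarrow> time (z c) x"
proof -
  have bdd: "\<exists>M. \<forall>n. U n \<le> M" if "U \<longlonglongrightarrow> l" for U and l :: real
    using Bseq_bdd_above[OF convergent_imp_Bseq[OF convergentI[OF that]]]
    by (auto simp: bdd_above_def)
  from bdd[OF X] obtain M where M: "\<And>n. X n \<le> M" by blast
  from bdd[OF C(1)] obtain K where K: "\<And>n. C n \<le> K" by blast
  with C(2)[of 0] have "K \<ge> 0" using order_trans by blast
  \<comment> \<open>Branches decrease in the parameter, so the one at the upper bound
    \<open>K\<close> has the largest reciprocal and dominates the whole sequence.\<close>
  have dom: "1 / z (C n) s \<le> 1 / z K s" if "s > 0" for n s
    using branch_comparison(1)[OF br[OF C(2)] br[OF \<open>K \<ge> 0\<close>] K, of s] that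
      branchD(3)[OF br[OF \<open>K \<ge> 0\<close>], of s] by (intro frac_le) auto
  show ?thesis
    unfolding time_def set_lebesgue_integral_def
  proof (rule integral_dominated_convergence[where w = "\<lambda>s. indicator {0<..<M} s *\<^sub>R (1 / z K s)"])
    show "(\<lambda>s. indicator {0<..<x} s *\<^sub>R (1 / z c s)) \<in> borel_measurable lborel"
      using branch_set_integrable[OF br] C(3) by (auto simp: set_integrable_def)
    show "(\<lambda>s. indicator {0<..<X n} s *\<^sub>R (1 / z (C n) s)) \<in> borel_measurable lborel" for n
      using branch_set_integrable[OF br] C(2) by (auto simp: set_integrable_def)
    show "integrable lborel (\<lambda>s. indicator {0<..<M} s *\<^sub>R (1 / z K s))"
      using branch_set_integrable[OF br] \<open>K \<ge> 0\<close> by (auto simp: set_integrable_def)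
    show "AE s in lborel. norm (indicator {0<..<X n} s *\<^sub>R (1 / z (C n) s))
        \<le> indicator {0<..<M} s *\<^sub>R (1 / z K s)" for n
    proof (rule AE_I2)
      fix s :: real
      show "norm (indicator {0<..<X n} s *\<^sub>R (1 / z (C n) s)) \<le> indicator {0<..<M} s *\<^sub>R (1 / z K s)"
      proof (cases "0 < s")
        case True
        then show ?thesis
          using dom[OF True, of n] M[of n] branchD(3)[OF br[OF C(2)] True, of n]
            branchD(3)[OF br[OF \<open>K \<ge> 0\<close>] True]
          by (auto simp: indicator_def)
      qed simp
    qed
    show "AE s in lborel. (\<lambda>n. indicator {0<..<X n} s *\<^sub>R (1 / z (C n) s))
        \<longlonglongrightarrow> indicator {0<..<x} s *\<^sub>R (1 / z c s)"
      \<comment> \<open>The indicators of \<open>{0<..<X n}\<close> may fail to converge at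
        \<open>s = x\<close>, a null set; elsewhere they are eventually constant.\<close>
      using AE_lborel_singleton[of x]
    proof eventually_elim
      fix s assume "s \<noteq> x"
      show "(\<lambda>n. indicator {0<..<X n} s *\<^sub>R (1 / z (C n) s)) \<longlonglongrightarrow> indicator {0<..<x} s *\<^sub>R (1 / z c s)"
      proof (cases "0 < s")
        case True
        have "eventually (\<lambda>n. indicator {0<..<X n} s = (indicator {0<..<x} s :: real)) sequentially"
        proof (cases "s < x")
          case True
          show ?thesis
            using order_tendstoD(1)[OF X True] by eventually_elim (simp add: True indicator_def)
        next
          case False
          with \<open>s \<noteq> x\<close> have "x < s" by simp
          show ?thesis
            using order_tendstoD(2)[OF X \<open>x < s\<close>]
            by eventually_elim (use \<open>x < s\<close> in \<open>simp add: indicator_def\<close>)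
        qed
        then have "(\<lambda>n. indicator {0<..<X n} s :: real) \<longlonglongrightarrow> indicator {0<..<x} s"
          by (rule tendsto_eventually)
        moreover have "(\<lambda>n. z (C n) s) \<longlonglongrightarrow> z c s"
          using True by (intro branch_parameter_continuous[OF br C]) auto
        ultimately show ?thesis
          using branchD(3)[OF br[OF \<open>c \<ge> 0\<close>] True] by (intro tendsto_intros) auto
      qed simp
    qed
  qed
qed

section \<open>Asymptotic expansion, uniform in the parameter\<close>

lemma time_minus_leading_term_le:
  assumes z: "branch c z" and "0 \<le> c" "0 < x"
    and small: "c * \<kappa> * x powr ((1 - \<alpha>) / 2) < 1 / 2"
  shows "time z x - leading_term \<alpha> \<Lambda> x \<le> 4 * \<kappa>\<^sup>2 * \<Lambda> / (1 - \<alpha>) * (c * x powr (1 - \<alpha>))"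
proof -
  define u where "u = c * \<kappa> * x powr ((1 - \<alpha>) / 2)"
  have "0 \<le> u" "u < 1 / 2"
    using assms \<kappa>_pos by (simp_all add: u_def)
  \<comment> \<open>The product equals \<open>(1 - u) * (1 + 2 * u) - 1\<close>, which linearises
    \<open>inverse (1 - u)\<close>; this is where the threshold 1/2 enters.\<close>
  have "0 \<le> u * (1 - 2 * u)"
    using \<open>0 \<le> u\<close> \<open>u < 1 / 2\<close> by (intro mult_nonneg_nonneg) auto
  then have "inverse (1 - u) \<le> 1 + 2 * u"
    using \<open>0 \<le> u\<close> \<open>u < 1 / 2\<close> by (simp add: field_simps)
  moreover have L: "0 \<le> leading_term \<alpha> \<Lambda> x"
    using \<kappa>_pos \<Lambda>_pos \<alpha>_less_1 by (simp add: leading_term_eq)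
  ultimately have "leading_term \<alpha> \<Lambda> x * inverse (1 - u) \<le> leading_term \<alpha> \<Lambda> x * (1 + 2 * u)"
    by (rule mult_left_mono)
  then have "time z x - leading_term \<alpha> \<Lambda> x \<le> leading_term \<alpha> \<Lambda> x * (2 * u)"
    using time_le[OF z \<open>0 \<le> c\<close>, of x] \<open>0 < x\<close> small by (simp add: u_def algebra_simps)
  also have "\<dots> = 4 * \<kappa>\<^sup>2 * \<Lambda> / (1 - \<alpha>) * (c * (x powr ((1 - \<alpha>) / 2) * x powr ((1 - \<alpha>) / 2)))"
    by (simp add: leading_term_eq u_def power2_eq_square)
  also have "x powr ((1 - \<alpha>) / 2) * x powr ((1 - \<alpha>) / 2) = x powr (1 - \<alpha>)"
    by (simp add: powr_add[symmetric])
  finally show ?thesis .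
qed

text \<open>The filter \<open>at_right 0 \<times>\<^sub>F principal K\<close> encodes uniformity:
  one neighbourhood of 0 has to serve all \<open>c\<close> in \<open>K\<close>. An upper bound
  \<open>M\<close> of \<open>K\<close> provides it, and the constant
  \<open>4 * \<kappa>\<^sup>2 * \<Lambda> / (1 - \<alpha>)\<close> is free of
  \<open>c\<close>.\<close>

lemma time_asymptotics:
  assumes br: "\<And>c. c \<ge> 0 \<Longrightarrow> branch c (z c)" and "bounded K" "K \<subseteq> {0..}"
  shows "(\<lambda>(x, c). time (z c) x - leading_term \<alpha> \<Lambda> x)
    \<in> O[at_right 0 \<times>\<^sub>F principal K](\<lambda>(x, c). c * x powr (1 - \<alpha>))"
proof -
  obtain M where M: "\<And>c. c \<in> K \<Longrightarrow> c \<le> M"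
    using \<open>bounded K\<close> unfolding bounded_iff by (metis abs_le_D1 real_norm_def)
  have "eventually (\<lambda>(x, c). norm (time (z c) x - leading_term \<alpha> \<Lambda> x)
      \<le> 4 * \<kappa>\<^sup>2 * \<Lambda> / (1 - \<alpha>) * norm (c * x powr (1 - \<alpha>))) (at_right 0 \<times>\<^sub>F principal K)"
    unfolding eventually_prod_filter
  proof (intro exI conjI allI impI)
    show "eventually (\<lambda>x. 0 < x \<and> M * \<kappa> * x powr ((1 - \<alpha>) / 2) < 1 / 2) (at_right 0)"
      by (intro eventually_conj eventually_defect_less eventually_at_right_less)
    show "eventually (\<lambda>c. c \<in> K) (principal K)"
      by (simp add: eventually_principal)
    fix x c assume x: "0 < x \<and> M * \<kappa> * x powr ((1 - \<alpha>) / 2) < 1 / 2" and "c \<in> K"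
    then have "0 \<le> c" using \<open>K \<subseteq> {0..}\<close> by auto
    have "c * \<kappa> * x powr ((1 - \<alpha>) / 2) \<le> M * \<kappa> * x powr ((1 - \<alpha>) / 2)"
      using M[OF \<open>c \<in> K\<close>] \<kappa>_pos by (intro mult_right_mono) auto
    with x have "c * \<kappa> * x powr ((1 - \<alpha>) / 2) < 1 / 2" by simp
    \<comment> \<open>The second fact makes the remainder nonnegative, so the one-sided estimate
      bounds its norm.\<close>
    from time_minus_leading_term_le[OF br _ _ this] leading_term_le_time[OF br, of c x]
    show "case (x, c) of (x, c) \<Rightarrow> norm (time (z c) x - leading_term \<alpha> \<Lambda> x)
      \<le> 4 * \<kappa>\<^sup>2 * \<Lambda> / (1 - \<alpha>) * norm (c * x powr (1 - \<alpha>))"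
      using \<open>0 \<le> c\<close> x by simp
  qed
  then show ?thesis
    by (intro bigoI[where c = "4 * \<kappa>\<^sup>2 * \<Lambda> / (1 - \<alpha>)"]) (simp only: case_prod_unfold)
qed

end

section \<open>Transfer to the settling times of the given manifolds\<close>

theorem lemma6p2:
  fixes \<alpha> \<Lambda> :: real and y :: "real \<Rightarrow> real \<Rightarrow> real"
  assumes "0 < \<alpha>" and "\<alpha> < 1" and "\<Lambda> > 0"
    and "\<And>c. c \<ge> 0 \<Longrightarrow> stable_manifold_fun \<alpha> \<Lambda> c (y c)"
  shows "(\<forall>x\<ge>0. \<forall>c\<ge>0. settling_time (y c) x < \<infinity>) \<and>
    continuous_on ({0..} \<times> {0..}) (\<lambda>(x, c). enn2real (settling_time (y c) x)) \<and>
    (\<forall>c\<ge>0. settling_time (y c) 0 = 0) \<and>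
    (\<forall>c>0. \<forall>x. 0 < x \<and> x < x1 \<alpha> \<Lambda> c \<longrightarrow>
        leading_term \<alpha> \<Lambda> x < enn2real (settling_time (y c) x) \<and>
        enn2real (settling_time (y c) x) <
          leading_term \<alpha> \<Lambda> x *
          inverse (1 - c * ((1 + \<alpha>) / (2 * \<Lambda>)) powr (1/2) * x powr ((1 - \<alpha>) / 2))) \<and>
    (\<forall>K. compact K \<and> K \<subseteq> {0..} \<longrightarrow>
        (\<lambda>(x, c). enn2real (settling_time (y c) x) - leading_term \<alpha> \<Lambda> x)
          \<in> O[at_right 0 \<times>\<^sub>F principal K](\<lambda>(x, c). c * x powr (1 - \<alpha>)))"
proof -
  interpret stable_branches \<alpha> \<Lambda>
    using assms(1-3) by unfold_locales
  define z where "z c x = - y c x" for c x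
  have br: "branch c (z c)" if "c \<ge> 0" for c
    using branch_stable_manifold_fun[OF assms(4)[OF that]] by (simp add: z_def[abs_def])
  have T: "settling_time (y c) x = ennreal (time (z c) x)" if "c \<ge> 0" for c x
    using settling_time_eq[OF assms(4)[OF that] that] by (simp add: z_def[abs_def])
  have T': "enn2real (settling_time (y c) x) = time (z c) x" if "c \<ge> 0" for c x
    using time_nonneg[OF br[OF that]] by (simp add: T[OF that])
  show ?thesis
  proof (intro conjI allI impI)
    show "settling_time (y c) x < \<infinity>" if "c \<ge> 0" for c x
      by (simp add: T[OF that])
    show "settling_time (y c) 0 = 0" if "c \<ge> 0" for c
      by (simp add: settling_time_def)
    show "continuous_on ({0..} \<times> {0..}) (\<lambda>(x, c). enn2real (settling_time (y c) x))"
    proof (rule continuous_on_sequentiallyI)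
      fix u :: "nat \<Rightarrow> real \<times> real" and a
      assume u: "\<forall>n. u n \<in> {0..} \<times> {0..}" and a: "a \<in> {0..} \<times> {0..}" and lim: "u \<longlonglongrightarrow> a"
      have nonneg: "snd (u n) \<ge> 0" for n using u by (metis SigmaE atLeast_iff snd_conv)
      have "(\<lambda>n. time (z (snd (u n))) (fst (u n))) \<longlonglongrightarrow> time (z (snd a)) (fst a)"
        using a by (intro time_sequentially_continuous br tendsto_fst tendsto_snd lim nonneg) auto
      then show "(\<lambda>n. case u n of (x, c) \<Rightarrow> enn2real (settling_time (y c) x))
          \<longlonglongrightarrow> (case a of (x, c) \<Rightarrow> enn2real (settling_time (y c) x))"
        using a nonneg by (auto simp: case_prod_beta T')
    qed
    fix c x assume "c > 0" and x: "0 < x \<and> x < x1 \<alpha> \<Lambda> c"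
    then have "c \<ge> 0" by simp
    show "leading_term \<alpha> \<Lambda> x < enn2real (settling_time (y c) x)"
      unfolding T'[OF \<open>c \<ge> 0\<close>]
      using x \<open>c > 0\<close> by (intro leading_term_less_time[OF br]) auto
    show "enn2real (settling_time (y c) x) < leading_term \<alpha> \<Lambda> x *
        inverse (1 - c * ((1 + \<alpha>) / (2 * \<Lambda>)) powr (1/2) * x powr ((1 - \<alpha>) / 2))"
      unfolding T'[OF \<open>c \<ge> 0\<close>] \<kappa>_def[symmetric]
      using x \<open>c > 0\<close> by (intro time_less[OF br] defect_less_1) auto
  next
    fix K :: "real set" assume K: "compact K \<and> K \<subseteq> {0..}"
    \<comment> \<open>\<open>T'\<close> holds only for \<open>c \<ge> 0\<close>; membership in
      \<open>K\<close> guarantees this, and the principal filter sees no other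
      \<open>c\<close>.\<close>
    have "eventually (\<lambda>(x, c). time (z c) x - leading_term \<alpha> \<Lambda> x
        = enn2real (settling_time (y c) x) - leading_term \<alpha> \<Lambda> x) (at_right 0 \<times>\<^sub>F principal K)"
      unfolding eventually_prod_filter
      by (rule exI[of _ "\<lambda>_. True"], rule exI[of _ "\<lambda>c. c \<in> K"])
         (use K T' in \<open>auto simp: eventually_principal\<close>)
    then show "(\<lambda>(x, c). enn2real (settling_time (y c) x) - leading_term \<alpha> \<Lambda> x)
        \<in> O[at_right 0 \<times>\<^sub>F principal K](\<lambda>(x, c). c * x powr (1 - \<alpha>))"
      using time_asymptotics[OF br compact_imp_bounded, of K] K
      by (subst landau_o.big.in_cong[where g = "\<lambda>(x, c). time (z c) x - leading_term \<alpha> \<Lambda> x"])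
         (auto simp: case_prod_beta elim: eventually_mono)
  qed
qed

end
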